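(* Let $\mathcal{X}\subset\mathbb{R}^d$ be an open subset, let $\hat\mu:\mathcal{X}\to\mathbb{R}$ and $\hat\sigma:\mathcal{X}\to(0,\infty)$ be arbitrary functions, and let $l>0$ and $\gamma\in\mathbb{R}$. Then the function $k^{PRBF}:\mathcal{X}\times\mathcal{X}\to\mathbb{R}$ given by $$k^{PRBF}(x,x')=\frac{\gamma^2}{\sqrt{2\pi\left(l^2+\hat\sigma(x)^2+\hat\sigma(x')^2\right)}}\exp\left(-\frac{(\hat\mu(x)-\hat\mu(x'))^2}{2\left(l^2+\hat\sigma(x)^2+\hat\sigma(x')^2\right)}\right)$$ is a positive-definite kernel on $\mathcal{X}$.
   Context: A kernel $k:\mathcal{X}\times\mathcal{X}\to\mathbb{R}$ is called positive-definite if it is symmetric and for every $m\in\mathbb{N}$, all $x_1,\dots,x_m\in\mathcal{X}$ and all $c_1,\dots,c_m\in\mathbb{R}$ one has $\sum_{j,k=1}^m c_jc_k\,k(x_j,x_k)\ge 0$ (non-strict inequality). *)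

theory Defs
  imports "HOL-Analysis.Analysis"
begin

(* A kernel on X is represented by a total function of which only the values on X \<times> X are used. *)

definition positive_definite_kernel_on :: "'a set \<Rightarrow> ('a \<Rightarrow> 'a \<Rightarrow> real) \<Rightarrow> bool" where
  "positive_definite_kernel_on X k \<longleftrightarrow>
     (\<forall>x\<in>X. \<forall>y\<in>X. k x y = k y x) \<and>
     (\<forall>(m::nat) (x::nat \<Rightarrow> 'a) (c::nat \<Rightarrow> real).
        (\<forall>i\<in>{1..m}. x i \<in> X) \<longrightarrow>
        (\<Sum>i=1..m. \<Sum>j=1..m. c i * c j * k (x i) (x j)) \<ge> 0)"

definition PRBF_kernel ::
  "real \<Rightarrow> real \<Rightarrow> ('a \<Rightarrow> real) \<Rightarrow> ('a \<Rightarrow> real) \<Rightarrow> 'a \<Rightarrow> 'a \<Rightarrow> real" where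
  "PRBF_kernel \<gamma> l \<mu> \<sigma> x x' =
     \<gamma>\<^sup>2 / sqrt (2 * pi * (l\<^sup>2 + (\<sigma> x)\<^sup>2 + (\<sigma> x')\<^sup>2)) *
     exp (- ((\<mu> x - \<mu> x')\<^sup>2 / (2 * (l\<^sup>2 + (\<sigma> x)\<^sup>2 + (\<sigma> x')\<^sup>2))))"

end

theory Submission
  imports Defs "HOL-Probability.Distributions"
begin

text \<open>
  The kernel is a Gram kernel: it is the \<open>L\<^sup>2\<close> inner product of features attached to the points.
  The factor in \<open>\<gamma>\<^sup>2\<close> aside, \<open>k x x'\<close> is the centred normal density of variance
  \<open>l\<^sup>2 + \<sigma>(x)\<^sup>2 + \<sigma>(x')\<^sup>2\<close>, evaluated at \<open>\<mu>(x) - \<mu>(x')\<close>. Splitting \<open>l\<^sup>2\<close> evenly makes this variance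
  the sum of \<open>l\<^sup>2/2 + \<sigma>(x)\<^sup>2\<close> and \<open>l\<^sup>2/2 + \<sigma>(x')\<^sup>2\<close>, each depending on one point only. Variances add
  under convolution, so the value is the integral of the product of the two normal densities with
  means \<open>\<mu>(x)\<close>, \<open>\<mu>(x')\<close> and these variances (\<open>normal_density_inner_product\<close>). A quadratic form in
  such integrals is the integral of a square (\<open>positive_definite_kernel_on_inner_product\<close>).
\<close>

text \<open>
  By linearity, the quadratic form with coefficients \<open>c i\<close> is the integral of
  \<open>(\<Sum>i. c i * f (x i) t)\<^sup>2\<close>.
\<close>

lemma positive_definite_kernel_on_inner_product:
  fixes f :: "'a \<Rightarrow> 'b \<Rightarrow> real"
  assumes k: "\<And>x y. x \<in> X \<Longrightarrow> y \<in> X \<Longrightarrow>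
    has_bochner_integral M (\<lambda>t. f x t * f y t) (k x y)"
  shows "positive_definite_kernel_on X k"
  unfolding positive_definite_kernel_on_def
proof (intro conjI ballI allI impI)
  fix x y assume xy: "x \<in> X" "y \<in> X"
  show "k x y = k y x"
    using k[OF xy] k[OF xy(2) xy(1)]
    by (auto simp: mult.commute intro: has_bochner_integral_eq)
next
  fix m :: nat and x :: "nat \<Rightarrow> 'a" and c :: "nat \<Rightarrow> real"
  assume x: "\<forall>i\<in>{1..m}. x i \<in> X"
  have "has_bochner_integral M
      (\<lambda>t. \<Sum>i=1..m. \<Sum>j=1..m. c i * c j * (f (x i) t * f (x j) t))
      (\<Sum>i=1..m. \<Sum>j=1..m. c i * c j * k (x i) (x j))"
    using x by (intro has_bochner_integral_sum has_bochner_integral_mult_right k) auto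
  also have "(\<lambda>t. \<Sum>i=1..m. \<Sum>j=1..m. c i * c j * (f (x i) t * f (x j) t)) =
      (\<lambda>t. (\<Sum>i=1..m. c i * f (x i) t)\<^sup>2)"
    by (simp add: power2_eq_square sum_product mult_ac)
  finally show "(\<Sum>i=1..m. \<Sum>j=1..m. c i * c j * k (x i) (x j)) \<ge> 0"
    by (auto dest!: has_bochner_integral_integral_eq[symmetric])
qed

text \<open>
  Translating the integration variable by \<open>b\<close> and reflecting the first density about its mean
  turns the integral into a convolution of centred normal densities at \<open>a - b\<close>.
\<close>

lemma normal_density_inner_product:
  assumes "0 < s" "0 < t"
  shows "has_bochner_integral lborel (\<lambda>y. normal_density a s y * normal_density b t y)
    (normal_density 0 (sqrt (s\<^sup>2 + t\<^sup>2)) (a - b))"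
proof -
  have "has_bochner_integral lborel
      (\<lambda>z. normal_density 0 s (a - b - z) * normal_density 0 t z)
      (normal_density 0 (sqrt (s\<^sup>2 + t\<^sup>2)) (a - b))"
    using fun_cong[OF conv_normal_density_zero_mean[OF assms], of "a - b"]
    by (intro has_bochner_integral_nn_integral) auto
  moreover have "normal_density 0 s (a - b - z) * normal_density 0 t z =
      normal_density a s (b + 1 * z) * normal_density b t (b + 1 * z)" for z
    by (simp add: normal_density_def power2_eq_square algebra_simps)
  ultimately show ?thesis
    by (subst lborel_has_bochner_integral_real_affine_iff[where c = 1 and t = b]) simp_all
qed

theorem mainTheorem2:
  fixes X :: "(real ^ 'd) set"
    and \<mu> \<sigma> :: "real ^ 'd \<Rightarrow> real"
    and l \<gamma> :: real
  assumes "open X"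
    and "\<And>x. x \<in> X \<Longrightarrow> \<sigma> x > 0"
    and "l > 0"
  shows "positive_definite_kernel_on X (PRBF_kernel \<gamma> l \<mu> \<sigma>)"
proof (rule positive_definite_kernel_on_inner_product)
  define s where "s x = sqrt (l\<^sup>2 / 2 + (\<sigma> x)\<^sup>2)" for x
  have s_pos: "0 < s x" for x
    using \<open>l > 0\<close> by (simp add: s_def add_pos_nonneg)
  have s_add: "(s x)\<^sup>2 + (s y)\<^sup>2 = l\<^sup>2 + (\<sigma> x)\<^sup>2 + (\<sigma> y)\<^sup>2" for x y
    by (simp add: s_def)
  fix x y
  have "has_bochner_integral lborel
      (\<lambda>t. \<gamma>\<^sup>2 * (normal_density (\<mu> x) (s x) t * normal_density (\<mu> y) (s y) t))
      (\<gamma>\<^sup>2 * normal_density 0 (sqrt ((s x)\<^sup>2 + (s y)\<^sup>2)) (\<mu> x - \<mu> y))"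
    by (intro has_bochner_integral_mult_right normal_density_inner_product s_pos)
  also have "\<gamma>\<^sup>2 * normal_density 0 (sqrt ((s x)\<^sup>2 + (s y)\<^sup>2)) (\<mu> x - \<mu> y) =
      PRBF_kernel \<gamma> l \<mu> \<sigma> x y"
    by (simp add: s_add normal_density_def PRBF_kernel_def)
  finally show "has_bochner_integral lborel
      (\<lambda>t. (\<gamma> * normal_density (\<mu> x) (s x) t) * (\<gamma> * normal_density (\<mu> y) (s y) t))
      (PRBF_kernel \<gamma> l \<mu> \<sigma> x y)"
    by (simp add: power2_eq_square mult_ac)
qed

end
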